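(* Let $(\mathcal{Q},\mathcal{P})$ be a misère quotient with $|\mathcal{P}| = 2$. Then either $(\mathcal{Q},\mathcal{P}) \cong \mathcal{T}_k$ for some $k \in \mathbb{N} \cup \{\infty\}$, or $(\mathcal{Q},\mathcal{P}) \cong \mathcal{R}_{2^k+4}$ for some integer $k \geq 2$, or $(\mathcal{Q},\mathcal{P}) \cong \mathcal{R}_\infty$.
   Context: Impartial games are identified with finite sets of games (a game is the set of its options), built recursively; $0 = \emptyset$, and $G+H$ is the game whose options are all $G'+H$ and $G+H'$ ($G'$ an option of $G$, $H'$ of $H$). Under misère play, $G$ is a $\mathscr{P}$-position if $G \neq 0$ and every option of $G$ is an $\mathscr{N}$-position; otherwise (in particular when $G=0$) $G$ is an $\mathscr{N}$-position. A set $\mathscr{A}$ of games is closed if it contains $0$ and is closed under taking options and under sums; $\mathrm{cl}(\mathscr{S})$ is the smallest closed set containing $\mathscr{S}$. For closed $\mathscr{A}$, $G \equiv_\mathscr{A} H$ iff for every $X \in \mathscr{A}$ the games $G+X$ and $H+X$ have the same misère outcome; the misère quotient $\mathcal{Q}(\mathscr{A})$ is the commutative monoid $\mathscr{A}/{\equiv_\mathscr{A}}$ together with the subset $\mathcal{P}$ of classes of $\mathscr{P}$-positions. A bipartite monoid is a pair $(\mathcal{Q},\mathcal{P})$ with $\mathcal{Q}$ a commutative monoid and $\mathcal{P}\subseteq\mathcal{Q}$; an isomorphism of bipartite monoids is a monoid isomorphism carrying the distinguished subset onto the distinguished subset. A bipartite monoid is a misère quotient if it is isomorphic to $\mathcal{Q}(\mathscr{A})$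 for some closed set $\mathscr{A}$. For an integer $k \geq 2$, $\mathcal{T}_k$ is the bipartite monoid with distinct elements $1, a, z_0, z_1, \ldots, z_{2^k-1}$, identity $1$, multiplication $a^2 = 1$, $z_iz_j = z_{i\oplus j}$, $az_i = z_{i\oplus 1}$ ($\oplus$ = bitwise XOR of nonnegative integers), and distinguished subset $\{a, z_0\}$. $\mathcal{T}_\infty$ is defined in the same way but with elements $z_i$ for all $i \in \mathbb{N}$. Also $\mathcal{T}_0 = (\{1\},\emptyset)$ and $\mathcal{T}_1 = (\{1,a\},\{a\})$ with $a^2=1$. For $k \geq 2$, $\mathcal{R}_{2^k+4}$ has underlying set $\mathcal{T}_k \cup \{t, at\}$ (two new elements), with multiplication extending that of $\mathcal{T}_k$ by $t\cdot 1 = t$, $t\cdot a = at$, $t^2 = z_0$, $tz_i = z_i$ for all $i$ (hence $(at)a = t$, $(at)t = z_1$, $(at)^2 = z_0$, $(at)z_i = z_{i\oplus 1}$), and distinguished subset $\{a,z_0\}$. $\mathcal{R}_\infty$ is obtained in the same way from $\mathcal{T}_\infty$. *)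

theory Defs
  imports "HOL-Algebra.Group" "HOL-Library.FSet" "HOL-Library.Extended_Nat"
begin

datatype game = Game (options: "game fset")

lemma size_option: "G |\<in>| options H \<Longrightarrow> size G < size H"
proof (cases H)
  case (Game S)
  assume "G |\<in>| options H"
  then have "Suc (size G) \<le> (\<Sum>x\<in>fset S. Suc (size x))"
    using Game by (intro member_le_sum) auto
  then show ?thesis
    using Game by simp
qed

instantiation game :: "{zero, plus}"
begin

definition zero_game :: game where
  "0 = Game {||}"

function plus_game :: "game \<Rightarrow> game \<Rightarrow> game" where
  "plus_game G H =
     Game ((\<lambda>G'. plus_game G' H) |`| options G |\<union>| (\<lambda>H'. plus_game G H') |`| options H)"
  by auto
termination
  by (relation "measure (\<lambda>(G, H). size G + size H)") (auto dest: size_option)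

instance ..

end

declare plus_game.simps [simp del]

function misere_P :: "game \<Rightarrow> bool" where
  "misere_P G \<longleftrightarrow> G \<noteq> 0 \<and> (\<forall>G'. G' |\<in>| options G \<longrightarrow> \<not> misere_P G')"
  by auto
termination
  by (relation "measure size") (auto dest: size_option)

declare misere_P.simps [simp del]

definition closed_games :: "game set \<Rightarrow> bool" where
  "closed_games A \<longleftrightarrow>
     0 \<in> A \<and>
     (\<forall>G\<in>A. \<forall>G'. G' |\<in>| options G \<longrightarrow> G' \<in> A) \<and>
     (\<forall>G\<in>A. \<forall>H\<in>A. G + H \<in> A)"

definition indist :: "game set \<Rightarrow> game rel" where
  "indist A = {(G, H). G \<in> A \<and> H \<in> A \<and>
     (\<forall>X\<in>A. misere_P (G + X) \<longleftrightarrow> misere_P (H + X))}"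

record 'a bipartite_monoid = "'a monoid" +
  dist_set :: "'a set"

locale bipartite_monoid = comm_monoid Q for Q :: "'a bipartite_monoid" (structure) +
  assumes dist_set_subset: "dist_set Q \<subseteq> carrier Q"

definition bipartite_iso :: "'a bipartite_monoid \<Rightarrow> 'b bipartite_monoid \<Rightarrow> bool"
    (infix "\<cong>\<^sub>b" 50) where
  "Q \<cong>\<^sub>b R \<longleftrightarrow>
     (\<exists>h \<in> iso Q R. h \<one>\<^bsub>Q\<^esub> = \<one>\<^bsub>R\<^esub> \<and> h ` dist_set Q = dist_set R)"

definition game_quotient :: "game set \<Rightarrow> game set bipartite_monoid" where
  "game_quotient A =
    \<lparr> carrier = A // indist A,
      mult = (\<lambda>X Y. \<Union>G\<in>X. \<Union>H\<in>Y. indist A `` {G + H}),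
      one = indist A `` {0},
      dist_set = {indist A `` {G} | G. G \<in> A \<and> misere_P G} \<rparr>"

definition misere_quotient :: "'a bipartite_monoid \<Rightarrow> bool" where
  "misere_quotient Q \<longleftrightarrow>
     bipartite_monoid Q \<and> (\<exists>A. closed_games A \<and> Q \<cong>\<^sub>b game_quotient A)"

text \<open>One carrier type serves all these monoids; \<open>Et\<close> and \<open>Eat\<close> occur only in the
  carriers of the monoids \<open>\<R>\<close>.\<close>

datatype elt = E1 | Ea | Ez nat | Et | Eat

unbundle bit_operations_syntax

fun elt_mult :: "elt \<Rightarrow> elt \<Rightarrow> elt" where
  "elt_mult E1 x = x"
| "elt_mult x E1 = x"
| "elt_mult Ea Ea = E1"
| "elt_mult Ea (Ez i) = Ez (i XOR 1)"
| "elt_mult (Ez i) Ea = Ez (i XOR 1)"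
| "elt_mult (Ez i) (Ez j) = Ez (i XOR j)"
| "elt_mult Et Ea = Eat"
| "elt_mult Ea Et = Eat"
| "elt_mult Et Et = Ez 0"
| "elt_mult Et (Ez i) = Ez i"
| "elt_mult (Ez i) Et = Ez i"
| "elt_mult Eat Ea = Et"
| "elt_mult Ea Eat = Et"
| "elt_mult Eat Et = Ez 1"
| "elt_mult Et Eat = Ez 1"
| "elt_mult Eat Eat = Ez 0"
| "elt_mult Eat (Ez i) = Ez (i XOR 1)"
| "elt_mult (Ez i) Eat = Ez (i XOR 1)"

unbundle no bit_operations_syntax

definition z_elts :: "enat \<Rightarrow> elt set" where
  "z_elts k = (case k of enat n \<Rightarrow> Ez ` {..<2 ^ n} | \<infinity> \<Rightarrow> range Ez)"

definition T_monoid :: "enat \<Rightarrow> elt bipartite_monoid" where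
  "T_monoid k =
    \<lparr> carrier = (if k = 0 then {E1} else if k = 1 then {E1, Ea} else {E1, Ea} \<union> z_elts k),
      mult = elt_mult,
      one = E1,
      dist_set = (if k = 0 then {} else if k = 1 then {Ea} else {Ea, Ez 0}) \<rparr>"

text \<open>For \<open>k \<ge> 2\<close> the monoid \<open>R_monoid k\<close> is indexed by the exponent \<open>k\<close> rather than by its
  order: \<open>R_monoid (enat k)\<close> is \<open>\<R>\<close> with subscript \<open>2 ^ k + 4\<close>.\<close>

definition R_monoid :: "enat \<Rightarrow> elt bipartite_monoid" where
  "R_monoid k =
    \<lparr> carrier = carrier (T_monoid k) \<union> {Et, Eat},
      mult = elt_mult,
      one = E1,
      dist_set = {Ea, Ez 0} \<rparr>"

end

(* The quotient map is treated as a function val from games to a monoid Q with distinguished subset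
   P = {a, z}, where a = val *. A smallest game with value b outside of {1, a} has options of both
   values 1 and a, hence acts as the nim heap of size two, and this forces b^2 = z = z^2. Induction on
   games then yields x^2 = z for all x outside of {1, a}, so that K = z Q is an elementary abelian
   2-group, and xw in P iff xwz = z for all x, w outside of {1, a}. By reducedness, an element
   x outside of {1, a} is determined by xz, unless xz is z or az; consequently Q is {1, a} together
   with K and possibly two further elements t, at with tz = z. Finally K is countable, since there
   are only countably many games, so it is isomorphic to an initial segment of (N, XOR). *)

theory Submission
  imports Defs "HOL-Algebra.FiniteProduct" "HOL-Library.Nat_Bijection" "HOL-Library.Countable_Set"
begin

section \<open>Sums of games and their misere outcomes\<close>

lemma options_plus:
  "options (G + H) = (\<lambda>G'. G' + H) |`| options G |\<union>| (\<lambda>H'. G + H') |`| options H"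
  by (subst plus_game.simps) simp

lemma option_plus_iff:
  "X |\<in>| options (G + H) \<longleftrightarrow>
     (\<exists>G'. G' |\<in>| options G \<and> X = G' + H) \<or> (\<exists>H'. H' |\<in>| options H \<and> X = G + H')"
  by (auto simp: options_plus)

lemma options_zero [simp]: "options (0 :: game) = {||}"
  by (simp add: zero_game_def)

lemma game_eq_zero_iff: "(G :: game) = 0 \<longleftrightarrow> options G = {||}"
  by (metis game.expand options_zero)

text \<open>A game is determined by its options, so each law is an equality of option sets; every
  option of a sum lowers the total size, which drives the inductions.\<close>

instance game :: comm_monoid_add
proof
  fix G H K :: game
  show "G + H + K = G + (H + K)"
  proof (induction "size G + size H + size K" arbitrary: G H K rule: less_induct)
    case less
    have "options (G + H + K) =
        ((\<lambda>G'. G' + H + K) |`| options G |\<union>| (\<lambda>H'. G + H' + K) |`| options H) |\<union>|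
        (\<lambda>K'. G + H + K') |`| options K"
      by (simp add: options_plus fimage_funion fset.map_comp comp_def)
    also have "(\<lambda>G'. G' + H + K) |`| options G = (\<lambda>G'. G' + (H + K)) |`| options G"
      by (rule fset.map_cong0) (auto intro!: less dest: size_option)
    also have "(\<lambda>H'. G + H' + K) |`| options H = (\<lambda>H'. G + (H' + K)) |`| options H"
      by (rule fset.map_cong0) (auto intro!: less dest: size_option)
    also have "(\<lambda>K'. G + H + K') |`| options K = (\<lambda>K'. G + (H + K')) |`| options K"
      by (rule fset.map_cong0) (auto intro!: less dest: size_option)
    finally have "options (G + H + K) = options (G + (H + K))"
      by (simp add: options_plus fimage_funion fset.map_comp comp_def sup_assoc)
    then show ?case
      by (rule game.expand)
  qed
next
  fix G H :: game
  show "G + H = H + G"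
  proof (induction "size G + size H" arbitrary: G H rule: less_induct)
    case less
    have "(\<lambda>G'. G' + H) |`| options G = (\<lambda>G'. H + G') |`| options G"
      by (rule fset.map_cong0) (auto intro!: less dest: size_option)
    moreover have "(\<lambda>H'. G + H') |`| options H = (\<lambda>H'. H' + G) |`| options H"
      by (rule fset.map_cong0) (auto intro!: less dest: size_option)
    ultimately have "options (G + H) = options (H + G)"
      by (simp add: options_plus sup_commute)
    then show ?case
      by (rule game.expand)
  qed
next
  fix G :: game
  show "0 + G = G"
  proof (induction "size G" arbitrary: G rule: less_induct)
    case less
    have "(\<lambda>H'. 0 + H') |`| options G = (\<lambda>H'. H') |`| options G"
      by (rule fset.map_cong0) (auto intro!: less dest: size_option)
    then have "options (0 + G) = options G"
      by (simp add: options_plus)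
    then show ?case
      by (rule game.expand)
  qed
qed

lemma game_plus_eq_zero_iff: "(G :: game) + H = 0 \<longleftrightarrow> G = 0 \<and> H = 0"
  by (auto simp: game_eq_zero_iff options_plus)

lemma misere_P_plus_iff:
  "misere_P (G + H) \<longleftrightarrow> (G \<noteq> 0 \<or> H \<noteq> 0) \<and>
     (\<forall>G'. G' |\<in>| options G \<longrightarrow> \<not> misere_P (G' + H)) \<and>
     (\<forall>H'. H' |\<in>| options H \<longrightarrow> \<not> misere_P (G + H'))"
  by (subst misere_P.simps) (auto simp: option_plus_iff game_plus_eq_zero_iff)

lemma not_misere_P_zero [simp]: "\<not> misere_P 0"
  by (subst misere_P.simps) simp

section \<open>The game star\<close>

definition star :: game where
  "star = Game {|0|}"

lemma options_star [simp]: "options star = {|0|}"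
  by (simp add: star_def)

lemma star_neq_zero [simp]: "star \<noteq> 0"
  by (metis options_star options_zero finsert_not_fempty)

lemma misere_P_star: "misere_P star"
  by (subst misere_P.simps) simp

text \<open>A move in \<open>star + star\<close> leads to \<open>star + X\<close>. For nonzero
  \<open>X\<close> in P this is harmless, because \<open>star + X\<close> can be answered by
  \<open>X\<close>; for \<open>X = 0\<close> it reaches \<open>star\<close>, which is in P, so both
  sides fail.\<close>

lemma misere_P_star_star_plus: "misere_P (star + star + X) \<longleftrightarrow> misere_P X"
proof (induction "size X" arbitrary: X rule: less_induct)
  case less
  have IH: "misere_P (star + star + X') \<longleftrightarrow> misere_P X'" if "X' |\<in>| options X" for X'
    using that by (intro less) (rule size_option)
  have opt: "Y |\<in>| options (star + star) \<longleftrightarrow> Y = star" for Y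
    by (auto simp: option_plus_iff)
  have P: "misere_P (star + star + X) \<longleftrightarrow>
      \<not> misere_P (star + X) \<and> (\<forall>X'. X' |\<in>| options X \<longrightarrow> \<not> misere_P X')"
    by (subst misere_P_plus_iff) (auto simp: opt IH game_plus_eq_zero_iff)
  show ?case
  proof (cases "X = 0")
    case True
    then show ?thesis
      using P by (simp add: misere_P_star)
  next
    case False
    have "\<not> misere_P (star + X)" if "misere_P X"
      using that misere_P_plus_iff[of star X] by auto
    then show ?thesis
      using P False misere_P.simps[of X] by auto
  qed
qed

text \<open>Descending through nonzero options ends at a nonzero game whose only option is
  \<open>0\<close>, which is \<open>star\<close>.\<close>

lemma star_mem_closed_games:
  assumes "closed_games A" and "G \<in> A" and "G \<noteq> 0"
  shows "star \<in> A"
  using assms(2,3)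
proof (induction "size G" arbitrary: G rule: less_induct)
  case less
  show ?case
  proof (cases "\<exists>G'. G' |\<in>| options G \<and> G' \<noteq> 0")
    case True
    then obtain G' where G': "G' |\<in>| options G" "G' \<noteq> 0" by blast
    moreover have "G' \<in> A"
      using assms(1) G' less.prems unfolding closed_games_def by blast
    ultimately show ?thesis
      using less.hyps size_option by blast
  next
    case False
    then have "G' |\<in>| options G \<longleftrightarrow> G' = 0" for G'
      using less.prems(2) by (metis game_eq_zero_iff all_not_fin_conv)
    then have "options G = {|0|}"
      by (intro fset_eqI) simp
    then have "G = star"
      by (simp add: game.expand)
    then show ?thesis
      using less.prems by simp
  qed
qed

section \<open>Elementary abelian 2-groups as initial segments of the naturals under XOR\<close>

unbundle bit_operations_syntax

text \<open>Bounding bit positions instead of numbers treats finite and infinite \<open>k\<close>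
  alike and makes closure under XOR immediate.\<close>

definition nats_below_exp :: "enat \<Rightarrow> nat set" where
  "nats_below_exp k = {i. \<forall>n. bit i n \<longrightarrow> enat n < k}"

lemma nats_below_exp_enat: "nats_below_exp (enat n) = {..<2 ^ n}"
proof -
  have "(\<forall>m. bit i m \<longrightarrow> m < n) \<longleftrightarrow> take_bit n i = i" for i :: nat
    by (auto simp: bit_eq_iff bit_take_bit_iff)
  then show ?thesis
    by (auto simp: nats_below_exp_def take_bit_nat_eq_self_iff)
qed

lemma z_elts_eq: "z_elts k = Ez ` nats_below_exp k"
  by (cases k) (simp_all add: z_elts_def nats_below_exp_enat, simp add: nats_below_exp_def)

lemma zero_in_nats_below_exp: "0 \<in> nats_below_exp k"
  by (simp add: nats_below_exp_def)

lemma one_in_nats_below_exp: "k \<noteq> 0 \<Longrightarrow> 1 \<in> nats_below_exp k"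
  by (auto simp: nats_below_exp_def bit_1_iff zero_enat_def[symmetric] simp del: One_nat_def)

lemma xor_in_nats_below_exp:
  "i \<in> nats_below_exp k \<Longrightarrow> j \<in> nats_below_exp k \<Longrightarrow> i XOR j \<in> nats_below_exp k"
  by (auto simp: nats_below_exp_def bit_xor_iff)

lemma bits_set_encode: "finite F \<Longrightarrow> bit (set_encode F) n \<longleftrightarrow> n \<in> F"
  using set_encode_inverse[of F] by (auto simp: set_decode_def bit_iff_odd)

lemma finite_bits: "finite {n. bit (i::nat) n}"
  using finite_set_decode[of i] by (simp add: set_decode_def bit_iff_odd)

text \<open>The factors over \<open>E \<inter> F\<close> occur twice on the right and cancel as
  squares. This turns XOR of bit sets into multiplication.\<close>

lemma (in comm_monoid) finprod_sym_diff:
  assumes fin: "finite E" "finite F"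
    and g: "g \<in> E \<union> F \<rightarrow> carrier G" and sq: "\<And>x. x \<in> carrier G \<Longrightarrow> x \<otimes> x = \<one>"
  shows "finprod G g (sym_diff E F) = finprod G g E \<otimes> finprod G g F"
proof -
  have gs: "g \<in> E - F \<rightarrow> carrier G" "g \<in> F - E \<rightarrow> carrier G" "g \<in> E \<inter> F \<rightarrow> carrier G"
    using g by auto
  have E: "finprod G g E = finprod G g (E - F) \<otimes> finprod G g (E \<inter> F)"
    using fin gs by (subst finprod_Un_disjoint[symmetric]) (auto simp: Un_Diff_Int)
  have F: "finprod G g F = finprod G g (F - E) \<otimes> finprod G g (E \<inter> F)"
    using fin gs by (subst finprod_Un_disjoint[symmetric]) (auto intro!: arg_cong[of _ _ "finprod G g"])
  have "finprod G g (sym_diff E F) = finprod G g (E - F) \<otimes> finprod G g (F - E)"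
    using fin gs by (intro finprod_Un_disjoint) auto
  also have "\<dots> = finprod G g (E - F) \<otimes> finprod G g (F - E) \<otimes>
      (finprod G g (E \<inter> F) \<otimes> finprod G g (E \<inter> F))"
    using gs by (simp add: sq)
  also have "\<dots> = finprod G g E \<otimes> finprod G g F"
    using gs by (simp add: E F m_ac)
  finally show ?thesis .
qed

lemma sym_diff_bits: "{n. bit (i XOR j :: nat) n} = sym_diff {n. bit i n} {n. bit j n}"
  by (auto simp: bit_xor_iff)

text \<open>A basis is extracted greedily from an enumeration of the group that starts with \<open>c\<close>; the
  binary digits of \<open>i\<close> are the coordinates of \<open>f i\<close>.\<close>

lemma (in comm_group) elementary_abelian_2_group_iso_xor:
  assumes count: "countable (carrier G)" and sq: "\<And>x. x \<in> carrier G \<Longrightarrow> x \<otimes> x = \<one>"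
    and c: "c \<in> carrier G" "c \<noteq> \<one>"
  obtains k :: enat and f :: "nat \<Rightarrow> 'a"
  where "bij_betw f (nats_below_exp k) (carrier G)" "f 0 = \<one>" "f 1 = c"
    and "\<And>i. f i \<in> carrier G" "\<And>i j. f (i XOR j) = f i \<otimes> f j"
proof -
  \<comment> \<open>Index 0 carries \<open>c\<close>, so that \<open>c\<close> becomes the first
    basis element.\<close>
  define \<kappa> where "\<kappa> n = (case n of 0 \<Rightarrow> c | Suc m \<Rightarrow> from_nat_into (carrier G) m)" for n
  have \<kappa>: "\<kappa> n \<in> carrier G" for n
    using c by (auto simp: \<kappa>_def split: nat.split intro: from_nat_into)
  have \<kappa>_onto: "\<exists>n. x = \<kappa> n" if x: "x \<in> carrier G" for x
    using from_nat_into_surj[OF count x] by (auto simp: \<kappa>_def intro: exI[of _ "Suc _"])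
  define q where "q F = finprod G \<kappa> F" for F
  have q [simp]: "q F \<in> carrier G" for F
    using \<kappa> by (auto simp: q_def intro: finprod_closed)
  have q_add: "q (sym_diff E F) = q E \<otimes> q F" if "finite E" "finite F" for E F
    unfolding q_def using that \<kappa> sq by (intro finprod_sym_diff) auto
  have q_insert: "q (insert n F) = \<kappa> n \<otimes> q F" if "finite F" "n \<notin> F" for n F
    unfolding q_def using that \<kappa> by (intro finprod_insert) auto
  have q_empty: "q {} = \<one>"
    by (simp add: q_def)
  \<comment> \<open>An index is kept iff its element is not a product of earlier ones: the greedy
    basis.\<close>
  define I where "I = {n. \<forall>F. F \<subseteq> {..<n} \<longrightarrow> q F \<noteq> \<kappa> n}"
  have I0: "0 \<in> I"
    using c by (simp add: I_def q_empty \<kappa>_def)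
  \<comment> \<open>In a nontrivial relation the element of largest index would be the product of
    the others, all earlier.\<close>
  have indep: "F = {}" if F: "finite F" "F \<subseteq> I" "q F = \<one>" for F
  proof (rule ccontr)
    assume "F \<noteq> {}"
    define n where "n = Max F"
    have n: "n \<in> F"
      using F \<open>F \<noteq> {}\<close> by (simp add: n_def)
    have sub: "F - {n} \<subseteq> {..<n}"
      using F(1) by (auto simp: n_def less_le)
    have "\<kappa> n \<otimes> q (F - {n}) = \<one>"
      using q_insert[of "F - {n}" n] F n by (simp add: insert_absorb)
    \<comment> \<open>Both sides are inverse to \<open>q (F - {n})\<close>.\<close>
    then have "q (F - {n}) = \<kappa> n"
      using inv_equality[of "\<kappa> n" "q (F - {n})"] inv_equality[of "q (F - {n})" "q (F - {n})"] \<kappa> sq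
      by simp
    then show False
      using sub n F(2) by (auto simp: I_def)
  qed
  have span: "\<exists>F. finite F \<and> F \<subseteq> I \<and> q F = \<kappa> n" for n
  proof (induction n rule: less_induct)
    case (less n)
    show ?case
    proof (cases "n \<in> I")
      case True
      then show ?thesis
        using q_insert[of "{}" n] \<kappa> by (intro exI[of _ "{n}"]) (simp add: q_empty)
    next
      case False
      then obtain E where E: "E \<subseteq> {..<n}" "q E = \<kappa> n"
        by (auto simp: I_def)
      have "finite E"
        using E(1) by (rule finite_subset) simp
      \<comment> \<open>Each factor of \<open>q E\<close> is replaced by its product over
        \<open>I\<close>, known from the outer induction; repeated indices cancel in the symmetric
        difference.\<close>
      then have "\<exists>F. finite F \<and> F \<subseteq> I \<and> q F = q E"
        using E(1)
      proof (induction E rule: finite_induct)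
        case empty
        then show ?case by blast
      next
        case (insert m E)
        then obtain F H where "finite F" "F \<subseteq> I" "q F = \<kappa> m" "finite H" "H \<subseteq> I" "q H = q E"
          using less.IH[of m] by auto
        then show ?case
          using insert q_add[of F H] q_insert[of E m] by (intro exI[of _ "sym_diff F H"]) auto
      qed
      then show ?thesis
        using E by simp
    qed
  qed
  define k where "k = (if finite I then enat (card I) else \<infinity>)"
  define e where "e = enumerate I"
  have e0: "e 0 = 0"
    using I0 by (simp add: e_def enumerate_0)
  have bij_e: "bij_betw e {n. enat n < k} I"
    using bij_enumerate[of I] finite_bij_enumerate[of I]
    by (auto simp: k_def e_def lessThan_def)
  \<comment> \<open>The product runs over bit positions and not over their image under
    \<open>e\<close>. Hence \<open>f\<close> stays in the group and respects XOR for every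
    \<open>i\<close>, even for positions beyond the basis, where \<open>e\<close> need not be
    injective.\<close>
  define f where "f i = finprod G (\<kappa> \<circ> e) {n. bit i n}" for i :: nat
  have f_closed [simp]: "f i \<in> carrier G" for i
    unfolding f_def using \<kappa> by (intro finprod_closed) auto
  have f_q: "f i = q (e ` {n. bit i n})" if "i \<in> nats_below_exp k" for i
  proof -
    have "inj_on e {n. bit i n}"
      using bij_e that by (auto simp: bij_betw_def nats_below_exp_def intro: inj_on_subset)
    then show ?thesis
      unfolding f_def q_def comp_def using \<kappa> by (subst finprod_reindex) auto
  qed
  have e_bits: "e ` {n. bit i n} \<subseteq> I" if "i \<in> nats_below_exp k" for i
    using bij_e that by (auto simp: bij_betw_def nats_below_exp_def)
  have f_xor: "f (i XOR j) = f i \<otimes> f j" for i j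
    unfolding f_def sym_diff_bits using \<kappa> sq by (intro finprod_sym_diff) (auto simp: finite_bits)
  have "inj_on f (nats_below_exp k)"
  proof (rule inj_onI)
    fix i j assume i: "i \<in> nats_below_exp k" and j: "j \<in> nats_below_exp k" and "f i = f j"
    then have "f (i XOR j) = \<one>"
      by (simp add: f_xor sq)
    then have "e ` {n. bit (i XOR j) n} = {}"
      using xor_in_nats_below_exp[OF i j] f_q e_bits finite_bits by (intro indep) auto
    then have "\<not> bit (i XOR j) n" for n
      by blast
    then show "i = j"
      by (intro bit_eqI) (simp add: bit_xor_iff)
  qed
  moreover have "f ` nats_below_exp k = carrier G"
  proof
    show "carrier G \<subseteq> f ` nats_below_exp k"
    proof
      fix x assume "x \<in> carrier G"
      then obtain F where F: "finite F" "F \<subseteq> I" "q F = x"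
        using \<kappa>_onto span by metis
      then obtain D where D: "D \<subseteq> {n. enat n < k}" "finite D" "F = e ` D"
        using bij_e by (metis bij_betw_def finite_subset_image)
      \<comment> \<open>The preimage of \<open>x\<close> is the number whose binary digits are the
        coordinates \<open>D\<close>.\<close>
      have "set_encode D \<in> nats_below_exp k"
        using D by (auto simp: nats_below_exp_def bits_set_encode)
      moreover have "f (set_encode D) = x"
        using f_q[OF calculation] D F by (simp add: bits_set_encode)
      ultimately show "x \<in> f ` nats_below_exp k"
        by blast
    qed
  qed auto
  ultimately have "bij_betw f (nats_below_exp k) (carrier G)"
    by (simp add: bij_betw_def)
  moreover have "f 0 = \<one>"
    by (simp add: f_def)
  moreover have "f 1 = c"
  proof -
    have "{n. bit (1::nat) n} = {0}"
      by (auto simp: bit_1_iff simp del: One_nat_def)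
    then show ?thesis
      using c by (simp add: f_def e0 \<kappa>_def)
  qed
  ultimately show thesis
    using that f_closed f_xor by blast
qed

unbundle no bit_operations_syntax

section \<open>Quotients with exactly two P-classes\<close>

text \<open>\<open>val\<close> stands for the quotient map followed by the isomorphism to
  \<open>Q\<close>, so all arithmetic takes place in \<open>Q\<close>; \<open>val_eqI\<close> keeps
  the fact that indistinguishable games are identified.\<close>

locale two_P_quotient = comm_monoid Q for Q :: "'a bipartite_monoid" (structure) +
  fixes A :: "game set" and val :: "game \<Rightarrow> 'a"
  assumes closed: "closed_games A"
    and carrier_eq: "carrier Q = val ` A"
    and val_plus: "G \<in> A \<Longrightarrow> H \<in> A \<Longrightarrow> val (G + H) = val G \<otimes> val H"
    and val_zero: "val 0 = \<one>"
    and val_in_dist_iff: "G \<in> A \<Longrightarrow> val G \<in> dist_set Q \<longleftrightarrow> misere_P G"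
    and val_eqI: "G \<in> A \<Longrightarrow> H \<in> A \<Longrightarrow>
      (\<And>X. X \<in> A \<Longrightarrow> misere_P (G + X) \<longleftrightarrow> misere_P (H + X)) \<Longrightarrow> val G = val H"
    and dist_subset: "dist_set Q \<subseteq> carrier Q"
    and card_dist: "card (dist_set Q) = 2"
begin

abbreviation P where "P \<equiv> dist_set Q"

lemma zero_mem: "0 \<in> A"
  using closed by (simp add: closed_games_def)

lemma option_mem: "G \<in> A \<Longrightarrow> G' |\<in>| options G \<Longrightarrow> G' \<in> A"
  using closed unfolding closed_games_def by blast

lemma plus_mem: "G \<in> A \<Longrightarrow> H \<in> A \<Longrightarrow> G + H \<in> A"
  using closed by (simp add: closed_games_def)

lemma val_closed [simp]: "G \<in> A \<Longrightarrow> val G \<in> carrier Q"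
  by (simp add: carrier_eq)

lemma carrierE:
  assumes "x \<in> carrier Q"
  obtains G where "G \<in> A" "x = val G"
  using assms by (auto simp: carrier_eq)

lemma val_mult_in_P_iff:
  assumes "G \<in> A" "H \<in> A"
  shows "val G \<otimes> val H \<in> P \<longleftrightarrow> (G \<noteq> 0 \<or> H \<noteq> 0) \<and>
     (\<forall>G'. G' |\<in>| options G \<longrightarrow> val G' \<otimes> val H \<notin> P) \<and>
     (\<forall>H'. H' |\<in>| options H \<longrightarrow> val G \<otimes> val H' \<notin> P)"
proof -
  have *: "val X \<otimes> val Y \<in> P \<longleftrightarrow> misere_P (X + Y)" if "X \<in> A" "Y \<in> A" for X Y
    using that by (simp add: val_plus[symmetric] val_in_dist_iff plus_mem)
  show ?thesis
    unfolding *[OF assms] misere_P_plus_iff[of G H] using assms option_mem * by blast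
qed

lemma val_in_P_iff:
  assumes "G \<in> A"
  shows "val G \<in> P \<longleftrightarrow> G \<noteq> 0 \<and> (\<forall>G'. G' |\<in>| options G \<longrightarrow> val G' \<notin> P)"
  unfolding val_in_dist_iff[OF assms] misere_P.simps[of G]
  using assms option_mem val_in_dist_iff by blast

text \<open>If \<open>x\<close> is the value of \<open>X\<close>, then \<open>G' + X\<close> is an
  option of \<open>G + X\<close>.\<close>

lemma option_mult_notin_P:
  assumes "G \<in> A" "x \<in> carrier Q" "G' |\<in>| options G" "val G \<otimes> x \<in> P"
  shows "val G' \<otimes> x \<notin> P"
proof -
  obtain X where "X \<in> A" "x = val X"
    using assms(2) by (rule carrierE)
  then show ?thesis
    using assms val_mult_in_P_iff[of G X] by blast
qed

text \<open>Every \<open>w\<close> is the value of a test game, so this is indistinguishability read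
  inside \<open>Q\<close>.\<close>

lemma reduced:
  assumes "x \<in> carrier Q" "y \<in> carrier Q"
    and "\<And>w. w \<in> carrier Q \<Longrightarrow> x \<otimes> w \<in> P \<longleftrightarrow> y \<otimes> w \<in> P"
  shows "x = y"
proof -
  obtain G H where GH: "G \<in> A" "x = val G" "H \<in> A" "y = val H"
    using assms(1,2) by (metis carrierE)
  have "misere_P (G + X) \<longleftrightarrow> misere_P (H + X)" if "X \<in> A" for X
    using assms(3)[of "val X"] that GH
    by (simp add: val_plus[symmetric] val_in_dist_iff plus_mem)
  then show ?thesis
    using GH val_eqI by blast
qed

lemma one_notin_P: "\<one> \<notin> P"
  using val_in_dist_iff[OF zero_mem] by (simp add: val_zero)

lemma star_mem: "star \<in> A"
proof -
  have "P \<noteq> {}"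
    using card_dist by auto
  then obtain p where "p \<in> P"
    by blast
  then obtain G where "G \<in> A" "val G \<in> P"
    using dist_subset carrierE by blast
  then show ?thesis
    using star_mem_closed_games[OF closed] val_in_P_iff by blast
qed

section \<open>The elements \<open>a\<close> and \<open>z\<close>, and a game like the nim heap of
  size two\<close>

definition a where "a = val star"

lemma a_closed [simp]: "a \<in> carrier Q"
  by (simp add: a_def star_mem)

lemma a_in_P: "a \<in> P"
  by (simp add: a_def val_in_dist_iff star_mem misere_P_star)

lemma a_neq_one: "a \<noteq> \<one>"
  using a_in_P one_notin_P by auto

lemma a_a [simp]: "a \<otimes> a = \<one>"
proof -
  have "val (star + star) = val 0"
    using star_mem by (intro val_eqI) (auto simp: plus_mem zero_mem misere_P_star_star_plus)
  then show ?thesis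
    by (simp add: a_def val_plus star_mem val_zero)
qed

lemma a_a_mult [simp]: "x \<in> carrier Q \<Longrightarrow> a \<otimes> (a \<otimes> x) = x"
  by (simp add: m_assoc[symmetric])

lemma a_mult_notin_P: "x \<in> P \<Longrightarrow> a \<otimes> x \<notin> P"
  using option_mult_notin_P[OF star_mem _ _, of x 0] dist_subset
  by (auto simp: a_def[symmetric] val_zero)

definition z where "z = (THE x. x \<in> P \<and> x \<noteq> a)"

lemma P_eq: "P = {a, z}" and z_neq_a [simp]: "z \<noteq> a"
proof -
  obtain x y where xy: "P = {x, y}" "x \<noteq> y"
    using card_dist by (auto simp: card_2_iff)
  then have "P = {a, x} \<and> x \<noteq> a \<or> P = {a, y} \<and> y \<noteq> a"
    using a_in_P by auto
  then obtain w where w: "P = {a, w}" "w \<noteq> a"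
    by metis
  then have "z = w"
    unfolding z_def by (intro the_equality) auto
  then show "P = {a, z}" "z \<noteq> a"
    using w by auto
qed

lemma z_in_P: "z \<in> P"
  by (simp add: P_eq)

lemma z_closed [simp]: "z \<in> carrier Q"
  using z_in_P dist_subset by blast

lemma z_neq_one [simp]: "z \<noteq> \<one>"
  using z_in_P one_notin_P by auto

text \<open>By induction on the test game \<open>X\<close>, the options of \<open>B + X\<close> and
  \<open>star + X\<close> fall into P alike: moves in the first summand all have the value of
  \<open>X\<close>, and such a move exists in both.\<close>

lemma val_all_options_one:
  assumes B: "B \<in> A" "B \<noteq> 0" and opt: "\<And>B'. B' |\<in>| options B \<Longrightarrow> val B' = \<one>"
  shows "val B = a"
proof -
  obtain B0 where B0: "B0 |\<in>| options B"
    using B by (auto simp: game_eq_zero_iff)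
  have "val B \<otimes> val X \<in> P \<longleftrightarrow> val star \<otimes> val X \<in> P" if "X \<in> A" for X
    using that
  proof (induction "size X" arbitrary: X rule: less_induct)
    case less
    have "val B \<otimes> val X' \<in> P \<longleftrightarrow> val star \<otimes> val X' \<in> P" if "X' |\<in>| options X" for X'
      using that less.hyps[of X'] size_option[of X' X] option_mem[of X X'] less.prems by blast
    then show ?case
      using B B0 star_mem less.prems
      by (auto simp: val_mult_in_P_iff[OF B(1)] val_mult_in_P_iff[OF star_mem] opt val_zero)
  qed
  then have "val B = val star"
    using B star_mem by (intro reduced) (auto elim!: carrierE)
  then show ?thesis
    by (simp add: a_def)
qed

text \<open>A move in \<open>B\<close> acts like a move to \<open>star + X\<close>, which can be
  reversed to \<open>X\<close>; so adding \<open>B\<close> changes no outcome.\<close>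

lemma val_all_options_a:
  assumes B: "B \<in> A" and opt: "\<And>B'. B' |\<in>| options B \<Longrightarrow> val B' = a"
  shows "val B = \<one>"
proof (cases "B = 0")
  case True
  then show ?thesis
    by (simp add: val_zero)
next
  case False
  then obtain B0 where B0: "B0 |\<in>| options B"
    by (auto simp: game_eq_zero_iff)
  have "val B \<otimes> val X \<in> P \<longleftrightarrow> val X \<in> P" if "X \<in> A" for X
    using that
  proof (induction "size X" arbitrary: X rule: less_induct)
    case less
    have IH: "val B \<otimes> val X' \<in> P \<longleftrightarrow> val X' \<in> P" if "X' |\<in>| options X" for X'
      using that less.hyps[of X'] size_option[of X' X] option_mem[of X X'] less.prems by blast
    have "val B \<otimes> val X \<in> P \<longleftrightarrow>
        a \<otimes> val X \<notin> P \<and> (\<forall>X'. X' |\<in>| options X \<longrightarrow> val X' \<notin> P)"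
      using False B0 by (auto simp: val_mult_in_P_iff[OF B less.prems] opt IH)
    \<comment> \<open>For \<open>X = 0\<close> the first conjunct fails since \<open>a\<close> is in
      \<open>P\<close>; otherwise the second conjunct says that \<open>val X\<close> is in
      \<open>P\<close>, which implies the first.\<close>
    moreover have "\<dots> \<longleftrightarrow> val X \<in> P"
    proof (cases "X = 0")
      case True
      then show ?thesis
        using a_in_P one_notin_P by (simp add: val_zero)
    next
      case False
      then show ?thesis
        using a_mult_notin_P[of "val X"] val_in_P_iff[OF less.prems] by blast
    qed
    ultimately show ?case
      by simp
  qed
  then show ?thesis
    using B by (intro reduced) (auto elim!: carrierE)
qed

text \<open>A game of minimal size whose value is neither \<open>1\<close> nor \<open>a\<close> behaves like the nim heap of
  size two.\<close>

lemma ex_nim_heap_2: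
  obtains B B\<^sub>0 B\<^sub>1 where "B \<in> A" "val B \<notin> {\<one>, a}"
    and "\<And>B'. B' |\<in>| options B \<Longrightarrow> val B' \<in> {\<one>, a}"
    and "B\<^sub>0 |\<in>| options B" "val B\<^sub>0 = \<one>" "B\<^sub>1 |\<in>| options B" "val B\<^sub>1 = a"
proof -
  define S where "S = {G \<in> A. val G \<notin> {\<one>, a}}"
  obtain Z where "Z \<in> A" "z = val Z"
    using z_closed by (rule carrierE)
  then have "Z \<in> S"
    using z_neq_a z_neq_one by (auto simp: S_def)
  then obtain B where BS: "B \<in> S" and min: "\<And>G. size G < size B \<Longrightarrow> G \<notin> S"
    using exists_least_iff[of "\<lambda>n. \<exists>G\<in>S. size G = n"] by metis
  have B: "B \<in> A" "val B \<notin> {\<one>, a}"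
    using BS by (auto simp: S_def)
  have opt: "val B' \<in> {\<one>, a}" if "B' |\<in>| options B" for B'
    using min[OF size_option[OF that]] option_mem[OF B(1) that] by (auto simp: S_def)
  have "B \<noteq> 0"
    using B val_zero by auto
  \<comment> \<open>Were either value missing among the options, the two preceding lemmas would
    force \<open>val B\<close> into \<open>{\<one>, a}\<close>.\<close>
  obtain B\<^sub>0 where "B\<^sub>0 |\<in>| options B" "val B\<^sub>0 = \<one>"
    using val_all_options_a[OF B(1)] opt B(2) by blast
  moreover obtain B\<^sub>1 where "B\<^sub>1 |\<in>| options B" "val B\<^sub>1 = a"
    using val_all_options_one[OF B(1) \<open>B \<noteq> 0\<close>] opt B(2) by blast
  ultimately show thesis
    using that B opt by blast
qed

section \<open>Powers of the heap value\<close>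

lemma a_z_notin_P: "a \<otimes> z \<notin> P"
  using a_mult_notin_P[OF z_in_P] .

lemma a_z_neq_z: "a \<otimes> z \<noteq> z"
  using a_z_notin_P z_in_P by auto

text \<open>For the heap value \<open>b\<close>, the second, fourth and sixth powers all lie in
  \<open>P\<close>, which has only the elements \<open>a\<close> and \<open>z\<close>; this leaves a
  single possibility.\<close>

lemma ex_square_eq_z:
  obtains b where "b \<in> carrier Q" "b \<notin> {\<one>, a}" "b \<otimes> b = z" "z \<otimes> z = z"
proof -
  obtain B B0 B1 where B: "B \<in> A" "val B \<notin> {\<one>, a}"
    and opt: "\<And>B'. B' |\<in>| options B \<Longrightarrow> val B' \<in> {\<one>, a}"
    and B0: "B0 |\<in>| options B" "val B0 = \<one>" and B1: "B1 |\<in>| options B" "val B1 = a"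
    by (rule ex_nim_heap_2) blast
  define b where "b = val B"
  have b [simp]: "b \<in> carrier Q"
    using B by (simp add: b_def)
  have move: "b \<otimes> x \<notin> P" "a \<otimes> (b \<otimes> x) \<notin> P" if "x \<in> P" for x
  proof -
    have x: "x \<in> carrier Q"
      using that dist_subset by blast
    show "b \<otimes> x \<notin> P"
      using option_mult_notin_P[OF B(1) x B0(1)] B0(2) x that by (auto simp: b_def)
    show "a \<otimes> (b \<otimes> x) \<notin> P"
      using option_mult_notin_P[OF B(1) _ B1(1), of "a \<otimes> x"] B1(2) x that B(1)
      by (auto simp: b_def m_lcomm)
  qed
  \<comment> \<open>\<open>T\<close> captures sums of copies of \<open>B\<close>: with one copy more
    than \<open>y\<close> accounts for, every option has value \<open>y\<close> or
    \<open>a \<otimes> y\<close>.\<close>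
  define T where "T y \<longleftrightarrow> y \<in> carrier Q \<and> (\<exists>G\<in>A. G \<noteq> 0 \<and> val G = b \<otimes> y \<and>
      (\<forall>G'. G' |\<in>| options G \<longrightarrow> val G' \<in> {y, a \<otimes> y}))" for y
  have T_one: "T \<one>"
    using B opt val_zero by (auto simp: T_def b_def intro!: bexI[of _ B])
  have T_step: "T (b \<otimes> y)" if T: "T y" for y
  proof -
    obtain G where G: "G \<in> A" "G \<noteq> 0" "val G = b \<otimes> y"
      and G': "\<And>G'. G' |\<in>| options G \<Longrightarrow> val G' \<in> {y, a \<otimes> y}"
      using T by (auto simp: T_def)
    have y: "y \<in> carrier Q"
      using T by (simp add: T_def)
    have "val X \<in> {b \<otimes> y, a \<otimes> (b \<otimes> y)}" if "X |\<in>| options (B + G)" for X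
      using that unfolding option_plus_iff
    proof (elim disjE exE conjE)
      fix B' assume "B' |\<in>| options B" "X = B' + G"
      then show ?thesis
        using opt[of B'] option_mem[of B B'] G B y by (auto simp: val_plus)
    next
      fix G'' assume "G'' |\<in>| options G" "X = B + G''"
      then show ?thesis
        using G'[of G''] option_mem[of G G''] G B y by (auto simp: val_plus b_def m_lcomm)
    qed
    then show ?thesis
      using G B y by (auto simp: T_def val_plus plus_mem b_def game_plus_eq_zero_iff
          intro!: bexI[of _ "B + G"])
  qed
  have T_P: "b \<otimes> y \<in> P" if T: "T y" and y: "y \<notin> P" "a \<otimes> y \<notin> P" for y
  proof -
    obtain G where "G \<in> A" "G \<noteq> 0" "val G = b \<otimes> y"
      and "\<And>G'. G' |\<in>| options G \<Longrightarrow> val G' \<in> {y, a \<otimes> y}"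
      using T by (auto simp: T_def)
    then show ?thesis
      using val_in_P_iff[of G] y by fastforce
  qed
  \<comment> \<open>From \<open>y\<close> in \<open>P\<close>, neither \<open>b \<otimes> y\<close>
    nor its multiple by \<open>a\<close> is in \<open>P\<close>; these are the only option values
    one step later, so P returns after two steps.\<close>
  have T_step2: "T (b \<otimes> (b \<otimes> y)) \<and> b \<otimes> (b \<otimes> y) \<in> P" if "T y" "y \<in> P" for y
    using that move[of y] T_step[of y] T_P[of "b \<otimes> y"] T_step[of "b \<otimes> y"] by auto
  have b_notin: "b \<notin> P" "a \<otimes> b \<notin> P"
  proof -
    show "b \<notin> P"
      using val_in_P_iff[OF B(1)] B1 a_in_P by (auto simp: b_def)
    show "a \<otimes> b \<notin> P"
      using option_mult_notin_P[OF B(1) a_closed B0(1)] B0(2) a_in_P B(1)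
      by (auto simp: b_def m_comm)
  qed
  have "T b"
    using T_step[OF T_one] by simp
  then have b2: "T (b \<otimes> b)" "b \<otimes> b \<in> P"
    using T_step T_P b_notin by auto
  have b4: "T ((b \<otimes> b) \<otimes> (b \<otimes> b))" "(b \<otimes> b) \<otimes> (b \<otimes> b) \<in> P"
    using T_step2[OF b2] by (simp_all add: m_assoc)
  have b6: "(b \<otimes> b) \<otimes> ((b \<otimes> b) \<otimes> (b \<otimes> b)) \<in> P"
    using T_step2[OF b4] by (simp_all add: m_assoc)
  \<comment> \<open>If the square were \<open>a\<close>, the fourth power would be
    \<open>\<one>\<close>, outside of \<open>P\<close>.\<close>
  have bb: "b \<otimes> b = z"
    using b2(2) b4(2) one_notin_P by (auto simp: P_eq)
  \<comment> \<open>Otherwise the sixth power would be \<open>a \<otimes> z\<close>, outside of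
    \<open>P\<close>.\<close>
  have "z \<otimes> z \<noteq> a"
    using b6 a_z_notin_P by (auto simp: bb m_comm)
  then have "z \<otimes> z = z"
    using b4(2) by (simp add: bb P_eq)
  then show thesis
    using that[OF b] bb B(2) by (simp add: b_def)
qed

section \<open>Squares\<close>

lemma z_z [simp]: "z \<otimes> z = z"
  by (rule ex_square_eq_z)

lemma z_z_mult [simp]: "x \<in> carrier Q \<Longrightarrow> z \<otimes> (z \<otimes> x) = z \<otimes> x"
  by (simp add: m_assoc[symmetric])

text \<open>An invertible idempotent is \<open>\<one>\<close>.\<close>

lemma z_no_inverse:
  assumes "x \<in> carrier Q"
  shows "z \<otimes> x \<noteq> \<one>"
proof
  assume "z \<otimes> x = \<one>"
  then have "z = \<one>"
    using z_z_mult[OF assms] by (metis r_one z_closed)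
  then show False
    by simp
qed

lemma a_z_neq_a: "a \<otimes> z \<noteq> a"
proof
  assume "a \<otimes> z = a"
  then have "a \<otimes> (a \<otimes> z) = a \<otimes> a"
    by simp
  then show False
    by simp
qed

text \<open>Induction on games with a mirror strategy: a move from \<open>G + G\<close> to
  \<open>G' + G\<close> is answered by \<open>G' + G'\<close>, which is in P by induction unless
  \<open>val G'\<close> is \<open>\<one>\<close> or \<open>a\<close>.\<close>

lemma square_in_P:
  assumes "x \<in> carrier Q" "x \<noteq> \<one>" "x \<noteq> a"
  shows "x \<otimes> x \<in> P"
proof -
  have "val G \<otimes> val G \<in> P" if "G \<in> A" "val G \<noteq> \<one>" "val G \<noteq> a" for G
    using that
  proof (induction "size G" arbitrary: G rule: less_induct)
    case less
    define x where "x = val G"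
    have x [simp]: "x \<in> carrier Q" "x \<noteq> \<one>" "x \<noteq> a"
      using less.prems by (auto simp: x_def)
    show ?case
    proof (cases "x = z \<or> x = a \<otimes> z")
      case True
      then have "x \<otimes> x = z"
        by (auto simp: m_ac)
      then show ?thesis
        using z_in_P by (simp add: x_def)
    next
      case False
      have "val G' \<otimes> x \<notin> P" if G': "G' |\<in>| options G" for G'
      proof (cases "val G' \<in> {\<one>, a}")
        \<comment> \<open>As \<open>x\<close> is none of \<open>\<one>\<close>, \<open>a\<close>,
          \<open>z\<close>, \<open>a \<otimes> z\<close>, neither \<open>x\<close> nor
          \<open>a \<otimes> x\<close> lies in \<open>P\<close>.\<close>
        case True
        have "a \<otimes> x \<noteq> z"
          using False a_a_mult[of x] by (metis x(1))
        moreover have "a \<otimes> x \<noteq> a"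
          using a_a_mult[of x] by (metis a_a x)
        ultimately show ?thesis
          using True False by (auto simp: P_eq)
      next
        case notin: False
        have G'A: "G' \<in> A"
          using less.prems(1) G' by (rule option_mem)
        have "val G' \<otimes> val G' \<in> P"
          using less.hyps[OF size_option[OF G'] G'A] notin by auto
        then show ?thesis
          using option_mult_notin_P[OF less.prems(1) _ G', of "val G'"] G'A
          by (metis m_comm option_mult_notin_P[OF less.prems(1) _ G'] val_closed x(1) x_def)
      qed
      moreover have "G \<noteq> 0"
        using less.prems val_zero by auto
      ultimately show ?thesis
        using val_mult_in_P_iff[OF less.prems(1) less.prems(1)] option_mem[OF less.prems(1)]
        by (metis m_comm val_closed x(1) x_def)
    qed
  qed
  then show ?thesis
    using assms by (metis carrierE)
qed

lemma a_mult_eq_a_iff: "x \<in> carrier Q \<Longrightarrow> a \<otimes> x = a \<longleftrightarrow> x = \<one>"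
  by (metis a_a_mult a_a r_one a_closed)

lemma a_mult_eq_z_iff: "x \<in> carrier Q \<Longrightarrow> a \<otimes> x = z \<longleftrightarrow> x = a \<otimes> z"
  by (metis a_a_mult z_closed)

lemma a_mult_eq_one_iff: "x \<in> carrier Q \<Longrightarrow> a \<otimes> x = \<one> \<longleftrightarrow> x = a"
  by (metis a_a_mult a_a r_one a_closed)

text \<open>With \<open>b \<otimes> b = z\<close> the left side is the square of
  \<open>x \<otimes> b\<close>, which is neither \<open>\<one>\<close> nor \<open>a\<close> because
  \<open>z\<close> divides no unit. So it lies in \<open>P\<close>, and being fixed by
  \<open>z\<close> it is not \<open>a\<close>.\<close>

lemma square_mult_z:
  assumes x: "x \<in> carrier Q"
  shows "x \<otimes> x \<otimes> z = z"
proof -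
  obtain b where b: "b \<in> carrier Q" "b \<notin> {\<one>, a}" "b \<otimes> b = z"
    by (rule ex_square_eq_z)
  define y where "y = x \<otimes> b"
  have yy: "y \<otimes> y = x \<otimes> x \<otimes> z"
    using x b by (simp add: y_def m_ac flip: b(3))
  have y [simp]: "y \<in> carrier Q"
    using x b by (simp add: y_def)
  have "z \<otimes> (x \<otimes> x) \<noteq> \<one>"
    using x by (intro z_no_inverse) simp
  then have "y \<otimes> y \<noteq> \<one>"
    using yy x by (simp add: m_comm)
  then have "y \<noteq> \<one>" "y \<noteq> a"
    by auto
  then have "x \<otimes> x \<otimes> z \<in> P"
    using square_in_P[OF y] yy by simp
  moreover have "x \<otimes> x \<otimes> z \<noteq> a"
  proof
    assume *: "x \<otimes> x \<otimes> z = a"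
    then have "x \<otimes> x \<otimes> z \<otimes> z = a \<otimes> z"
      by simp
    moreover have "x \<otimes> x \<otimes> z \<otimes> z = x \<otimes> x \<otimes> z"
      using x by (simp add: m_assoc)
    ultimately show False
      using * a_z_neq_a by simp
  qed
  ultimately show ?thesis
    by (simp add: P_eq)
qed

lemma square_eq_z:
  assumes "x \<in> carrier Q" "x \<noteq> \<one>" "x \<noteq> a"
  shows "x \<otimes> x = z"
  using square_in_P[OF assms] square_mult_z[OF assms(1)] a_z_neq_z by (auto simp: P_eq)

section \<open>Cancellation modulo \<open>z\<close> and membership of products in
  \<open>P\<close>\<close>

lemma square_mult_mult_z:
  assumes "x \<in> carrier Q" "y \<in> carrier Q"
  shows "x \<otimes> (x \<otimes> (y \<otimes> z)) = y \<otimes> z"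
proof -
  have "x \<otimes> (x \<otimes> (y \<otimes> z)) = y \<otimes> (x \<otimes> x \<otimes> z)"
    using assms by (simp add: m_ac)
  then show ?thesis
    using square_mult_z[OF assms(1)] by simp
qed

text \<open>Otherwise, adding a test game of value \<open>val G \<otimes> z\<close> to
  \<open>G\<close> and to \<open>G'\<close> would give the same value \<open>z\<close> in
  \<open>P\<close>, although one sum is an option of the other.\<close>

lemma option_mult_z_neq:
  assumes G: "G \<in> A" and G': "G' |\<in>| options G"
  shows "val G' \<otimes> z \<noteq> val G \<otimes> z"
proof
  assume *: "val G' \<otimes> z = val G \<otimes> z"
  have G'A: "G' \<in> A"
    using G G' by (rule option_mem)
  have "val G \<otimes> (val G \<otimes> z) \<in> P"
    using square_mult_z[of "val G"] G z_in_P by (simp add: m_assoc)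
  then have "val G' \<otimes> (val G \<otimes> z) \<notin> P"
    using option_mult_notin_P[OF G _ G'] G by simp
  moreover have "val G' \<otimes> (val G \<otimes> z) = val G \<otimes> (val G' \<otimes> z)"
    using G G'A by (simp add: m_lcomm)
  ultimately show False
    using * \<open>val G \<otimes> (val G \<otimes> z) \<in> P\<close> by simp
qed

text \<open>The equation makes \<open>x\<close> invertible; outside of \<open>{\<one>, a}\<close>
  its square \<open>z\<close> would then be invertible too.\<close>

lemma unit_imp:
  assumes x: "x \<in> carrier Q" and y: "y \<in> carrier Q" and "x \<otimes> y = a"
  shows "x \<in> {\<one>, a}"
proof (rule ccontr)
  assume "x \<notin> {\<one>, a}"
  then have "z \<otimes> (y \<otimes> y) = x \<otimes> x \<otimes> (y \<otimes> y)"
    using square_eq_z[OF x] by simp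
  also have "\<dots> = (x \<otimes> y) \<otimes> (x \<otimes> y)"
    using x y by (simp add: m_ac)
  also have "\<dots> = \<one>"
    using assms by simp
  finally show False
    using z_no_inverse[of "y \<otimes> y"] y by simp
qed

text \<open>A product of two such elements is never \<open>a\<close>, so in \<open>P\<close> it can
  only be \<open>z\<close>. Conversely, options cannot have the same image modulo \<open>z\<close>,
  so none of them reaches \<open>P\<close>.\<close>

lemma mult_in_P_iff:
  assumes x: "x \<in> carrier Q" "x \<notin> {\<one>, a}" and w: "w \<in> carrier Q" "w \<notin> {\<one>, a}"
  shows "x \<otimes> w \<in> P \<longleftrightarrow> x \<otimes> w \<otimes> z = z"
proof
  assume "x \<otimes> w \<in> P"
  then have "x \<otimes> w = z"
    using unit_imp[OF x(1) w(1)] x(2) by (auto simp: P_eq)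
  then show "x \<otimes> w \<otimes> z = z"
    by simp
next
  \<comment> \<open>Stated for either order of the factors, to cover moves in both summands. If
    \<open>v \<otimes> val H'\<close> were \<open>z\<close>, then \<open>val H'\<close> and
    \<open>val H\<close> would both agree with \<open>v\<close> after multiplication by
    \<open>z\<close>.\<close>
  have option_notin: "val H' \<otimes> v \<notin> P"
    if uv: "u \<otimes> v \<otimes> z = z" and u: "u = val H" "H \<in> A" and v: "v \<in> carrier Q" "v \<notin> {\<one>, a}"
      and H': "H' |\<in>| options H" for u v H H'
  proof
    have H'A: "H' \<in> A"
      using u(2) H' by (rule option_mem)
    assume "val H' \<otimes> v \<in> P"
    moreover have "v \<otimes> val H' \<noteq> a"
      using unit_imp[OF v(1) _, of "val H'"] H'A v(2) by auto
    ultimately have "v \<otimes> val H' = z"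
      using H'A v by (simp add: P_eq m_comm)
    then have "v \<otimes> (v \<otimes> (val H' \<otimes> z)) = v \<otimes> z"
      using H'A v by (simp flip: m_assoc)
    moreover have "v \<otimes> (v \<otimes> (val H \<otimes> z)) = v \<otimes> z"
      using uv u v by (simp add: m_ac)
    ultimately show False
      using option_mult_z_neq[OF u(2) H'] H'A u v by (simp add: square_mult_mult_z)
  qed
  assume xwz: "x \<otimes> w \<otimes> z = z"
  obtain G H where GH: "G \<in> A" "x = val G" "H \<in> A" "w = val H"
    using x w by (metis carrierE)
  have "val G' \<otimes> w \<notin> P" if "G' |\<in>| options G" for G'
    using option_notin[OF xwz GH(2,1) w that] .
  moreover have "val G \<otimes> val H' \<notin> P" if H': "H' |\<in>| options H" for H'
    using option_notin[OF _ GH(4,3) x H'] xwz option_mem[OF GH(3) H'] GH x w by (simp add: m_comm)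
  moreover have "G \<noteq> 0"
    using x GH val_zero by auto
  ultimately show "x \<otimes> w \<in> P"
    using val_mult_in_P_iff[OF GH(1,3)] GH by simp
qed

text \<open>Against tests outside of \<open>{\<one>, a}\<close> only the multiple by
  \<open>z\<close> matters; the tests \<open>\<one>\<close> and \<open>a\<close> detect just whether
  the element is \<open>z\<close> or \<open>a \<otimes> z\<close>.\<close>

lemma eq_by_mult_z:
  assumes x: "x \<in> carrier Q" "x \<notin> {\<one>, a}" and y: "y \<in> carrier Q" "y \<notin> {\<one>, a}"
    and xyz: "x \<otimes> z = y \<otimes> z" and eq: "x = z \<longleftrightarrow> y = z" "x = a \<otimes> z \<longleftrightarrow> y = a \<otimes> z"
  shows "x = y"
proof (rule reduced)
  have a_mult: "a \<otimes> u \<in> P \<longleftrightarrow> u = a \<otimes> z" if "u \<in> carrier Q" "u \<notin> {\<one>, a}" for u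
    using that by (auto simp: P_eq a_mult_eq_a_iff a_mult_eq_z_iff)
  fix w assume w: "w \<in> carrier Q"
  show "x \<otimes> w \<in> P \<longleftrightarrow> y \<otimes> w \<in> P"
  proof (cases "w \<in> {\<one>, a}")
    case True
    then show ?thesis
      using x y eq a_mult[of x] a_mult[of y] by (auto simp: P_eq m_comm)
  next
    case False
    have "x \<otimes> w \<otimes> z = y \<otimes> w \<otimes> z"
      using xyz x y w by (metis m_assoc m_comm z_closed)
    then show ?thesis
      using mult_in_P_iff[OF x w False] mult_in_P_iff[OF y w False] by simp
  qed
qed (use x y in auto)

end

section \<open>Countability of the set of games\<close>

lemma finite_games_size_less: "finite {G :: game. size G < n}"
proof (induction n)
  case (Suc n)
  \<comment> \<open>All options are smaller, so the next stage embeds into the power set of the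
    previous one.\<close>
  have "fset S \<subseteq> {G :: game. size G < n}" if "size (Game S) < Suc n" for S
    using that size_option[of _ "Game S"] by fastforce
  then have "{G :: game. size G < Suc n} \<subseteq> Game ` {S. fset S \<subseteq> {G :: game. size G < n}}"
    by (metis (no_types, lifting) game.exhaust image_eqI mem_Collect_eq subsetI)
  moreover have "finite {S. fset S \<subseteq> {G :: game. size G < n}}"
  proof (rule finite_imageD)
    show "finite (fset ` {S. fset S \<subseteq> {G :: game. size G < n}})"
      by (rule finite_subset[of _ "Pow {G :: game. size G < n}"]) (use Suc in auto)
  qed (simp add: inj_on_def fset_inject)
  ultimately show ?case
    using finite_surj by blast
qed simp

lemma countable_games: "countable (S :: game set)"
proof -
  have "(UNIV :: game set) = (\<Union>n. {G :: game. size G < n})"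
    by blast
  then have "countable (UNIV :: game set)"
    by (metis countable_UN countableI_type countable_finite finite_games_size_less)
  then show ?thesis
    by (rule countable_subset[rotated]) simp
qed

text \<open>The map goes from the model \<open>R\<close> to \<open>Q\<close>, since it is easily
  defined by cases on the model; its inverse is the isomorphism.\<close>

lemma bipartite_isoI:
  assumes g: "bij_betw g (carrier R) (carrier Q)"
    and closed: "\<And>x y. x \<in> carrier R \<Longrightarrow> y \<in> carrier R \<Longrightarrow> x \<otimes>\<^bsub>R\<^esub> y \<in> carrier R"
    and mult: "\<And>x y. x \<in> carrier R \<Longrightarrow> y \<in> carrier R \<Longrightarrow> g (x \<otimes>\<^bsub>R\<^esub> y) = g x \<otimes>\<^bsub>Q\<^esub> g y"
    and one: "\<one>\<^bsub>R\<^esub> \<in> carrier R" "g \<one>\<^bsub>R\<^esub> = \<one>\<^bsub>Q\<^esub>"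
    and dist: "dist_set R \<subseteq> carrier R" "g ` dist_set R = dist_set Q"
  shows "Q \<cong>\<^sub>b R"
proof -
  define h where "h = inv_into (carrier R) g"
  have hg: "h (g x) = x" if "x \<in> carrier R" for x
    using g that by (simp add: h_def bij_betw_def)
  have gh: "h x \<in> carrier R" "g (h x) = x" if "x \<in> carrier Q" for x
    using g that unfolding h_def bij_betw_def by (auto intro: inv_into_into f_inv_into_f)
  have "h (x \<otimes>\<^bsub>Q\<^esub> y) = h x \<otimes>\<^bsub>R\<^esub> h y" if "x \<in> carrier Q" "y \<in> carrier Q" for x y
    using hg[of "h x \<otimes>\<^bsub>R\<^esub> h y"] that by (simp add: gh closed mult)
  then have "h \<in> iso Q R"
    using bij_betw_inv_into[OF g] gh(1) by (auto simp: iso_def hom_def h_def)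
  moreover have "h \<one>\<^bsub>Q\<^esub> = \<one>\<^bsub>R\<^esub>"
    using hg[OF one(1)] one(2) by simp
  moreover have "h ` dist_set Q = dist_set R"
    using dist hg by (force simp: image_image simp flip: dist(2))
  ultimately show ?thesis
    unfolding bipartite_iso_def by blast
qed

section \<open>The multiples of \<open>z\<close> and the elements outside\<close>

context two_P_quotient
begin

text \<open>As \<open>z\<close> is idempotent, its multiples are the elements fixed by it; they form
  a group with identity \<open>z\<close>.\<close>

definition K where "K = {x \<in> carrier Q. x \<otimes> z = x}"

lemma K_carrier: "x \<in> K \<Longrightarrow> x \<in> carrier Q"
  by (simp add: K_def)

lemma K_mult_z: "x \<in> K \<Longrightarrow> x \<otimes> z = x"
  by (simp add: K_def)

lemma mult_mem_K: "x \<in> carrier Q \<Longrightarrow> y \<in> K \<Longrightarrow> x \<otimes> y \<in> K"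
  by (simp add: K_def m_assoc)

lemma z_mem_K: "z \<in> K"
  by (simp add: K_def)

lemma one_notin_K: "\<one> \<notin> K"
  by (simp add: K_def)

lemma a_notin_K: "a \<notin> K"
  using a_z_neq_a by (simp add: K_def)

lemma K_square: "x \<in> K \<Longrightarrow> x \<otimes> x = z"
  using square_mult_z[of x] by (simp add: K_def m_assoc)

text \<open>The heap has options of values \<open>\<one>\<close> and \<open>a\<close>, so modulo
  \<open>z\<close> it differs from both. This gives \<open>K\<close> at least two binary
  dimensions.\<close>

lemma ex_third_K:
  obtains x where "x \<in> K" "x \<noteq> z" "x \<noteq> a \<otimes> z"
proof -
  obtain B B\<^sub>0 B\<^sub>1 where B: "B \<in> A"
    and opt: "B\<^sub>0 |\<in>| options B" "val B\<^sub>0 = \<one>" "B\<^sub>1 |\<in>| options B" "val B\<^sub>1 = a"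
    by (rule ex_nim_heap_2) blast
  show thesis
  proof (rule that)
    show "val B \<otimes> z \<in> K"
      using B by (intro mult_mem_K z_mem_K) simp
    show "val B \<otimes> z \<noteq> z"
      using option_mult_z_neq[OF B opt(1)] opt(2) by auto
    show "val B \<otimes> z \<noteq> a \<otimes> z"
      using option_mult_z_neq[OF B opt(3)] opt(4) by auto
  qed
qed

text \<open>Otherwise \<open>x\<close> would coincide with its image \<open>x z\<close> in \<open>K\<close>.\<close>

lemma notin_K_mult_z:
  assumes x: "x \<in> carrier Q" "x \<notin> {\<one>, a}" "x \<notin> K"
  shows "x \<otimes> z \<in> {z, a \<otimes> z}"
proof (rule ccontr)
  assume *: "x \<otimes> z \<notin> {z, a \<otimes> z}"
  have xz: "x \<otimes> z \<in> K"
    using mult_mem_K[OF x(1) z_mem_K] .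
  have "x = x \<otimes> z"
  proof (rule eq_by_mult_z)
    show "x = z \<longleftrightarrow> x \<otimes> z = z" "x = a \<otimes> z \<longleftrightarrow> x \<otimes> z = a \<otimes> z"
      using * by (auto simp: m_assoc)
    show "x \<otimes> z \<notin> {\<one>, a}"
      using xz one_notin_K a_notin_K by auto
  qed (use x in \<open>auto simp: m_assoc\<close>)
  then show False
    using xz x by simp
qed

text \<open>Modulo \<open>z\<close>, \<open>x\<close> agrees with \<open>t\<close> or with
  \<open>a \<otimes> t\<close>. As \<open>z\<close> and \<open>a \<otimes> z\<close> lie in
  \<open>K\<close>, the exceptional conditions of \<open>eq_by_mult_z\<close> fail on both
  sides.\<close>

lemma notin_K_cases:
  assumes t: "t \<in> carrier Q" "t \<notin> {\<one>, a}" "t \<notin> K" "t \<otimes> z = z"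
    and x: "x \<in> carrier Q" "x \<notin> {\<one>, a}" "x \<notin> K"
  shows "x = t \<or> x = a \<otimes> t"
proof -
  have eq: "x = y" if y: "y \<in> carrier Q" "y \<notin> {\<one>, a}" "y \<notin> K" "x \<otimes> z = y \<otimes> z" for y
    using x y z_mem_K mult_mem_K[OF a_closed z_mem_K] by (rule_tac eq_by_mult_z) auto
  have at: "a \<otimes> t \<notin> {\<one>, a}" "a \<otimes> t \<notin> K"
    using t mult_mem_K[of a "a \<otimes> t"] by (auto simp: a_mult_eq_a_iff a_mult_eq_one_iff)
  show ?thesis
    using notin_K_mult_z[OF x] eq[of t] eq[of "a \<otimes> t"] t at by (auto simp: m_assoc)
qed

text \<open>Either \<open>x\<close> or \<open>a \<otimes> x\<close> has image \<open>z\<close>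
  modulo \<open>z\<close>.\<close>

lemma ex_t:
  assumes x: "x \<in> carrier Q" "x \<notin> {\<one>, a}" "x \<notin> K"
  obtains t where "t \<in> carrier Q" "t \<notin> {\<one>, a}" "t \<notin> K" "t \<otimes> z = z"
proof (cases "x \<otimes> z = z")
  case True
  then show ?thesis
    using that x by blast
next
  case False
  then have xz: "x \<otimes> z = a \<otimes> z"
    using notin_K_mult_z[OF x] by blast
  have "a \<otimes> x \<notin> {\<one>, a}" "a \<otimes> x \<notin> K"
    using x mult_mem_K[of a "a \<otimes> x"] by (auto simp: a_mult_eq_a_iff a_mult_eq_one_iff)
  then show ?thesis
    using that[of "a \<otimes> x"] x xz by (simp add: m_assoc)
qed

unbundle bit_operations_syntax

lemma K_iso_xor:
  obtains k :: enat and f :: "nat \<Rightarrow> 'a"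
  where "bij_betw f (nats_below_exp k) K" "f 0 = z" "f 1 = a \<otimes> z" "k \<noteq> 0" "k \<noteq> 1"
    and "\<And>i. f i \<in> K" "\<And>i j. f (i XOR j) = f i \<otimes> f j"
proof -
  \<comment> \<open>Every element of \<open>K\<close> is its own inverse relative to the identity
    \<open>z\<close>.\<close>
  define G where "G = \<lparr>carrier = K, mult = (\<otimes>), one = z\<rparr>"
  interpret G: comm_group G
    by (rule comm_groupI)
      (auto simp: G_def z_mem_K K_square K_mult_z K_carrier mult_mem_K m_ac intro!: bexI)
  have count: "countable (carrier G)"
    using countable_subset[of K "val ` A"] countable_image[OF countable_games[of A], of val]
    by (simp add: G_def K_def carrier_eq subset_iff)
  have sq: "x \<otimes>\<^bsub>G\<^esub> x = \<one>\<^bsub>G\<^esub>" if "x \<in> carrier G" for x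
    using that K_square by (simp add: G_def)
  \<comment> \<open>Giving \<open>a \<otimes> z\<close> the index 1 makes multiplication by
    \<open>a\<close> on \<open>K\<close> act as XOR with 1.\<close>
  have az: "a \<otimes> z \<in> carrier G" "a \<otimes> z \<noteq> \<one>\<^bsub>G\<^esub>"
    using mult_mem_K[OF a_closed z_mem_K] a_z_neq_z by (simp_all add: G_def)
  obtain k f where "bij_betw f (nats_below_exp k) (carrier G)" "f 0 = \<one>\<^bsub>G\<^esub>"
    "f 1 = a \<otimes> z" "\<And>i. f i \<in> carrier G" "\<And>i j. f (i XOR j) = f i \<otimes>\<^bsub>G\<^esub> f j"
    by (rule G.elementary_abelian_2_group_iso_xor[OF count _ az], erule sq) (rule that)
  then have f: "bij_betw f (nats_below_exp k) K" "f 0 = z" "f 1 = a \<otimes> z"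
    and f_K: "\<And>i. f i \<in> K" and f_xor: "\<And>i j. f (i XOR j) = f i \<otimes> f j"
    by (simp_all add: G_def)
  obtain x where "x \<in> K" "x \<noteq> z" "x \<noteq> a \<otimes> z"
    by (rule ex_third_K)
  moreover from \<open>x \<in> K\<close> obtain i where "i \<in> nats_below_exp k" "x = f i"
    using f(1) unfolding bij_betw_def by blast
  ultimately have "\<not> nats_below_exp k \<subseteq> {0, 1}"
    using f(2,3) by auto
  moreover have "nats_below_exp 0 \<subseteq> {0, 1}" "nats_below_exp 1 \<subseteq> {0, 1}"
    unfolding zero_enat_def one_enat_def nats_below_exp_enat by auto
  ultimately have "k \<noteq> 0" "k \<noteq> 1"
    by metis+
  then show thesis
    by (rule that[OF f _ _ f_K f_xor])
qed

section \<open>Assembling the isomorphism\<close>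

lemma bipartite_iso_T_or_R:
  "(\<exists>k. Q \<cong>\<^sub>b T_monoid k) \<or> (\<exists>k. k \<noteq> 0 \<and> k \<noteq> 1 \<and> Q \<cong>\<^sub>b R_monoid k)"
proof -
  obtain k f where f: "bij_betw f (nats_below_exp k) K" "f 0 = z" "f 1 = a \<otimes> z"
    and k: "k \<noteq> 0" "k \<noteq> 1"
    and f_K: "\<And>i. f i \<in> K" and f_xor: "\<And>i j. f (i XOR j) = f i \<otimes> f j"
    by (rule K_iso_xor) blast
  have f_closed [simp]: "f i \<in> carrier Q" for i
    using f_K K_carrier by blast
  have f_a_z: "f i \<otimes> (a \<otimes> z) = a \<otimes> f i" for i
    using K_mult_z[OF f_K[of i]] by (simp add: m_lcomm)
  have f_Suc_0: "f (Suc 0) = a \<otimes> z"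
    using f(3) by simp
  define g where "g t x = (case x of E1 \<Rightarrow> \<one> | Ea \<Rightarrow> a | Ez i \<Rightarrow> f i | Et \<Rightarrow> t | Eat \<Rightarrow> a \<otimes> t)"
    for t x
  have g_simps [simp]: "g t E1 = \<one>" "g t Ea = a" "g t (Ez i) = f i" "g t Et = t" "g t Eat = a \<otimes> t"
    for t i
    by (simp_all add: g_def)
  have g_z_elts: "g t ` z_elts k = K" for t
    using f(1) by (simp add: z_elts_eq image_image bij_betw_def)
  have inj_z_elts: "inj_on (g t) (z_elts k)" for t
    using f(1) by (auto simp: z_elts_eq bij_betw_def inj_on_def)
  have bij_T: "bij_betw (g t) (carrier (T_monoid k)) ({\<one>, a} \<union> K)" for t
  proof -
    have "bij_betw (g t) {E1, Ea} {\<one>, a}"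
      using a_neq_one by (auto simp: bij_betw_def)
    moreover have "bij_betw (g t) (z_elts k) K"
      using g_z_elts inj_z_elts by (simp add: bij_betw_def)
    ultimately show ?thesis
      using bij_betw_combine[of "g t" "{E1, Ea}" "{\<one>, a}" "z_elts k" K] k one_notin_K a_notin_K
      by (simp add: T_monoid_def)
  qed
  \<comment> \<open>Valid on all of \<open>elt\<close>, as \<open>f_xor\<close> has no bound on the
    indices; so one case analysis serves both models.\<close>
  have mult: "g t (elt_mult x y) = g t x \<otimes> g t y"
    if t: "t \<in> carrier Q" "t \<otimes> z = z" "t \<otimes> t = z" for t x y
  proof -
    have tf: "t \<otimes> f i = f i" for i
    proof -
      have "t \<otimes> f i = t \<otimes> z \<otimes> f i"
        using t(1) K_mult_z[OF f_K[of i]] by (simp add: m_ac)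
      then show ?thesis
        using t(2) K_mult_z[OF f_K[of i]] by (simp add: m_comm)
    qed
    then have ft: "f i \<otimes> t = f i" "f i \<otimes> (a \<otimes> t) = a \<otimes> f i" for i
      using t(1) tf by (simp_all add: m_comm[of "f i"] m_assoc)
    have tt: "t \<otimes> (t \<otimes> x) = z \<otimes> x" if "x \<in> carrier Q" for x
      using t(1,3) that by (simp flip: m_assoc)
    have att: "a \<otimes> t \<otimes> t = a \<otimes> z" "t \<otimes> (a \<otimes> t) = a \<otimes> z" "a \<otimes> t \<otimes> (a \<otimes> t) = z"
      using t tt[OF a_closed] by (simp_all add: m_ac)
    show ?thesis
      using t(1) by (cases x; cases y)
        (simp_all add: f_xor f_Suc_0 f_a_z f(2) tf ft att t(3) m_assoc m_comm[of _ a])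
  qed
  have z0: "Ez 0 \<in> z_elts k"
    by (simp add: z_elts_eq zero_in_nats_below_exp)
  have xor_z: "Ez (i XOR j) \<in> z_elts k" if "Ez i \<in> z_elts k" "Ez j \<in> z_elts k" for i j
    using that xor_in_nats_below_exp by (auto simp: z_elts_eq)
  have z1: "Ez (Suc 0) \<in> z_elts k"
    using one_in_nats_below_exp[OF k(1)] by (simp add: z_elts_eq)
  have z_elts_Ez: "x \<in> z_elts k \<Longrightarrow> \<exists>i. x = Ez i" for x
    by (auto simp: z_elts_eq)
  have closed_T: "elt_mult x y \<in> carrier (T_monoid k)"
    if "x \<in> carrier (T_monoid k)" "y \<in> carrier (T_monoid k)" for x y
    using that k z0 z1 xor_z[OF _ z1] xor_z
    by (cases x; cases y) (auto simp: T_monoid_def dest: z_elts_Ez)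
  have closed_R: "elt_mult x y \<in> carrier (R_monoid k)"
    if "x \<in> carrier (R_monoid k)" "y \<in> carrier (R_monoid k)" for x y
    using that k z0 z1 xor_z[OF _ z1] xor_z
    by (cases x; cases y) (auto simp: T_monoid_def R_monoid_def dest: z_elts_Ez)
  show ?thesis
  proof (cases "carrier Q = {\<one>, a} \<union> K")
    case True
    have "Q \<cong>\<^sub>b T_monoid k"
    proof (rule bipartite_isoI)
      \<comment> \<open>\<open>Et\<close> and \<open>Eat\<close> lie outside this carrier;
        \<open>z\<close> is a stand-in for their parameter that satisfies the conditions of
        \<open>mult\<close>.\<close>
      show "bij_betw (g z) (carrier (T_monoid k)) (carrier Q)"
        using bij_T True by simp
      show "x \<otimes>\<^bsub>T_monoid k\<^esub> y \<in> carrier (T_monoid k)"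
        if "x \<in> carrier (T_monoid k)" "y \<in> carrier (T_monoid k)" for x y
        using closed_T[OF that] by (simp add: T_monoid_def)
      show "g z (x \<otimes>\<^bsub>T_monoid k\<^esub> y) = g z x \<otimes> g z y" for x y
        using mult[of z x y] by (simp add: T_monoid_def)
    qed (use k z0 in \<open>auto simp: T_monoid_def P_eq f(2)\<close>)
    then show ?thesis
      by blast
  next
    case False
    then obtain x where "x \<in> carrier Q" "x \<notin> {\<one>, a}" "x \<notin> K"
      using K_carrier by auto
    then obtain t where t: "t \<in> carrier Q" "t \<notin> {\<one>, a}" "t \<notin> K" "t \<otimes> z = z"
      by (rule ex_t)
    have at: "a \<otimes> t \<notin> {\<one>, a}" "a \<otimes> t \<notin> K"
      using t mult_mem_K[of a "a \<otimes> t"] by (auto simp: a_mult_eq_a_iff a_mult_eq_one_iff)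
    \<comment> \<open>Multiplying by \<open>z\<close> would identify \<open>a \<otimes> z\<close>
      with \<open>z\<close>.\<close>
    have "a \<otimes> t \<noteq> t"
    proof
      assume "a \<otimes> t = t"
      then have "a \<otimes> t \<otimes> z = z"
        using t by simp
      then show False
        using t a_z_neq_z by (simp add: m_assoc)
    qed
    then have "bij_betw (g t) {Et, Eat} {t, a \<otimes> t}"
      by (auto simp: bij_betw_def)
    moreover have "({\<one>, a} \<union> K) \<inter> {t, a \<otimes> t} = {}"
      using t at by auto
    moreover have "carrier Q = {\<one>, a} \<union> K \<union> {t, a \<otimes> t}"
      using notin_K_cases[OF t] t(1) K_carrier by auto
    ultimately have bij_R: "bij_betw (g t) (carrier (R_monoid k)) (carrier Q)"
      using bij_betw_combine[OF bij_T[of t], of "{Et, Eat}" "{t, a \<otimes> t}"] by (simp add: R_monoid_def)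
    have tt: "t \<otimes> t = z"
      using square_eq_z t by auto
    have "Q \<cong>\<^sub>b R_monoid k"
    proof (rule bipartite_isoI[OF bij_R])
      show "x \<otimes>\<^bsub>R_monoid k\<^esub> y \<in> carrier (R_monoid k)"
        if "x \<in> carrier (R_monoid k)" "y \<in> carrier (R_monoid k)" for x y
        using closed_R[OF that] by (simp add: R_monoid_def)
      show "g t (x \<otimes>\<^bsub>R_monoid k\<^esub> y) = g t x \<otimes> g t y" for x y
        using mult[OF t(1,4) tt] by (simp add: R_monoid_def)
    qed (use k z0 in \<open>auto simp: R_monoid_def T_monoid_def P_eq f(2)\<close>)
    then show ?thesis
      using k by blast
  qed
qed

unbundle no bit_operations_syntax

end

section \<open>From a misere quotient to its value map\<close>

lemma equiv_indist: "equiv A (indist A)"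
  by (auto simp: equiv_def indist_def refl_on_def sym_def trans_def)

lemma indist_iff: "(G, H) \<in> indist A \<longleftrightarrow>
    G \<in> A \<and> H \<in> A \<and> (\<forall>X\<in>A. misere_P (G + X) \<longleftrightarrow> misere_P (H + X))"
  by (simp add: indist_def)

text \<open>The summands are exchanged one at a time, the other one being absorbed into the test
  game.\<close>

lemma indist_plus:
  assumes A: "closed_games A" and "(G, G') \<in> indist A" "(H, H') \<in> indist A"
  shows "(G + H, G' + H') \<in> indist A"
proof -
  have plus: "X + Y \<in> A" if "X \<in> A" "Y \<in> A" for X Y
    using A that by (simp add: closed_games_def)
  have mem: "G \<in> A" "G' \<in> A" "H \<in> A" "H' \<in> A"
    using assms(2,3) by (auto simp: indist_iff)
  have "misere_P (G + H + X) \<longleftrightarrow> misere_P (G' + H' + X)" if "X \<in> A" for X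
  proof -
    have "misere_P (G + (H + X)) \<longleftrightarrow> misere_P (G' + (H + X))"
      using assms(2) plus mem that by (simp add: indist_iff)
    moreover have "misere_P (H + (G' + X)) \<longleftrightarrow> misere_P (H' + (G' + X))"
      using assms(3) plus mem that by (simp add: indist_iff)
    ultimately show ?thesis
      by (simp add: ac_simps)
  qed
  then show ?thesis
    using plus mem by (simp add: indist_iff)
qed

lemma misere_P_indist:
  assumes "closed_games A" "(G, H) \<in> indist A"
  shows "misere_P G \<longleftrightarrow> misere_P H"
  using assms by (auto simp: indist_iff closed_games_def dest: bspec[of _ _ 0])

lemma game_quotient_mult:
  assumes A: "closed_games A" and G: "G \<in> A" and H: "H \<in> A"
  shows "indist A `` {G} \<otimes>\<^bsub>game_quotient A\<^esub> indist A `` {H} = indist A `` {G + H}"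
proof -
  have "indist A `` {G' + H'} = indist A `` {G + H}"
    if "(G, G') \<in> indist A" "(H, H') \<in> indist A" for G' H'
    using equiv_class_eq[OF equiv_indist indist_plus[OF A that]] by simp
  moreover have "(G, G) \<in> indist A" "(H, H) \<in> indist A"
    using G H by (simp_all add: indist_iff)
  ultimately have "(\<Union>G'\<in>indist A `` {G}. \<Union>H'\<in>indist A `` {H}. indist A `` {G' + H'}) =
      indist A `` {G + H}"
    by blast
  then show ?thesis
    by (simp add: game_quotient_def)
qed

lemma misere_quotient_imp_two_P_quotient:
  fixes Q :: "'a bipartite_monoid"
  assumes Q: "misere_quotient Q" and card: "card (dist_set Q) = 2"
  obtains A val where "two_P_quotient Q A val"
proof -
  interpret bipartite_monoid Q
    using Q by (simp add: misere_quotient_def)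
  obtain A h where A: "closed_games A" and h: "h \<in> iso Q (game_quotient A)"
    and h_one: "h \<one>\<^bsub>Q\<^esub> = \<one>\<^bsub>game_quotient A\<^esub>"
    and h_dist: "h ` dist_set Q = dist_set (game_quotient A)"
    using Q by (auto simp: misere_quotient_def bipartite_iso_def)
  define cls where "cls G = indist A `` {G}" for G
  have carrier: "carrier (game_quotient A) = cls ` A"
    by (auto simp: game_quotient_def quotient_def cls_def)
  have cls_eq: "cls G = cls H \<longleftrightarrow> (G, H) \<in> indist A" if "G \<in> A" "H \<in> A" for G H
    using that eq_equiv_class_iff[OF equiv_indist] by (simp add: cls_def)
  have bij: "bij_betw h (carrier Q) (cls ` A)"
    using h by (simp add: iso_def carrier)
  have h_mult: "h (x \<otimes>\<^bsub>Q\<^esub> y) = h x \<otimes>\<^bsub>game_quotient A\<^esub> h y"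
    if "x \<in> carrier Q" "y \<in> carrier Q" for x y
    using h that by (simp add: iso_def hom_def)
  \<comment> \<open>The inverse of the isomorphism is applied to the class of a game.\<close>
  define val where "val G = inv_into (carrier Q) h (cls G)" for G
  have val: "val G \<in> carrier Q" "h (val G) = cls G" if "G \<in> A" for G
    using bij that by (simp_all add: val_def bij_betw_def inv_into_into f_inv_into_f)
  have val_eqI: "x = val G" if "x \<in> carrier Q" "G \<in> A" "h x = cls G" for x G
    using bij that val[of G] by (metis bij_betw_def inj_onD)
  have zero: "0 \<in> A"
    using A by (simp add: closed_games_def)
  have "two_P_quotient Q A val"
  proof unfold_locales
    show "closed_games A" by (fact A)
    show "card (dist_set Q) = 2" by (fact card)
    show "dist_set Q \<subseteq> carrier Q" by (fact dist_set_subset)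
    show "carrier Q = val ` A"
    proof
      show "carrier Q \<subseteq> val ` A"
      proof
        fix x assume x: "x \<in> carrier Q"
        then obtain G where "G \<in> A" "h x = cls G"
          using bij_betwE[OF bij] by blast
        then show "x \<in> val ` A"
          using val_eqI[OF x] by blast
      qed
    qed (use val in auto)
    show "val (G + H) = val G \<otimes>\<^bsub>Q\<^esub> val H" if "G \<in> A" "H \<in> A" for G H
      using that val A game_quotient_mult[OF A that]
      by (intro val_eqI[symmetric]) (auto simp: h_mult cls_def closed_games_def)
    show "val 0 = \<one>\<^bsub>Q\<^esub>"
      using zero h_one by (intro val_eqI[symmetric]) (auto simp: cls_def game_quotient_def)
    show "val G \<in> dist_set Q \<longleftrightarrow> misere_P G" if G: "G \<in> A" for G
    proof -
      have "val G \<in> dist_set Q \<longleftrightarrow> cls G \<in> h ` dist_set Q"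
        using G val[OF G] bij dist_set_subset inj_on_image_mem_iff[of h "carrier Q" "val G" "dist_set Q"]
        by (simp add: bij_betw_def)
      also have "\<dots> \<longleftrightarrow> (\<exists>H\<in>A. cls G = cls H \<and> misere_P H)"
        unfolding h_dist by (auto simp: game_quotient_def cls_def)
      also have "\<dots> \<longleftrightarrow> misere_P G"
        using G cls_eq misere_P_indist[OF A] by blast
      finally show ?thesis .
    qed
    show "val G = val H"
      if "G \<in> A" "H \<in> A" "\<And>X. X \<in> A \<Longrightarrow> misere_P (G + X) \<longleftrightarrow> misere_P (H + X)" for G H
      using that cls_eq[of G H] by (simp add: val_def indist_iff)
  qed
  then show thesis
    by (rule that)
qed

theorem theorem3p8:
  fixes Q :: "'a bipartite_monoid"
  assumes "misere_quotient Q"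
    and "card (dist_set Q) = 2"
  shows "(\<exists>k::enat. Q \<cong>\<^sub>b T_monoid k) \<or>
         (\<exists>k::nat. k \<ge> 2 \<and> Q \<cong>\<^sub>b R_monoid (enat k)) \<or>
         Q \<cong>\<^sub>b R_monoid \<infinity>"
proof -
  obtain A val where "two_P_quotient Q A val"
    using misere_quotient_imp_two_P_quotient[OF assms] .
  then interpret two_P_quotient Q A val .
  have "(\<exists>n\<ge>2. k = enat n) \<or> k = \<infinity>" if "k \<noteq> 0" "k \<noteq> 1" for k :: enat
    using that by (cases k) (auto simp: zero_enat_def one_enat_def)
  then show ?thesis
    using bipartite_iso_T_or_R by metis
qed

end
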